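(* Let $\mathcal H$ be a separable Hilbert space, let $\mathbf J\in\mathcal B(\mathcal H)$ be skew-adjoint and $\mathbf R\in\mathcal B(\mathcal H)$ self-adjoint with $\dim\ker\mathbf R<\infty$. Then there exist an integer $s\ge2$ and a direct sum decomposition $\mathcal H=\bigoplus_{i=1}^s\mathcal H_i$ with each $\mathcal H_i$ a (possibly zero) subspace of $\mathcal H$ such that: (1) $\dim\mathcal H_i<\infty$ for $i=2,\dots,s$; (2) the components of $\mathbf J$ with respect to this decomposition satisfy $\mathbf J_{j,k}=-(\mathbf J_{k,j})^*$ for all $j,k$, $\mathbf J_{j,k}=0$ for $|j-k|\ge2$, and $\mathbf J_{s,s-1}=0$, $\mathbf J_{s-1,s}=0$ (so $\mathbf J$ is a block tridiagonal operator matrix on $\mathcal H_1\oplus\dots\oplus\mathcal H_{s-1}$, together with a decoupled diagonal block $\mathbf J_{s,s}$); (3) if $s\ge3$, then $\mathbf J_{i,i-1}:\mathcal H_{i-1}\to\mathcal H_i$ is surjective (and hence $-(\mathbf J_{i,i-1})^*$ is injective) for $i=2,\dots,s-1$; (4) $\mathbf R_{j,k}=0$ for $j+k>2$ and $\mathbf R_{1,1}=(\mathbf R_{1,1})^*$; (5) if $\mathbf R$ is nonsingular, then $s=2$ and $\mathcal H_2=\{0\}$.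
   Context: $\mathcal B(\mathcal H)$ is the space of bounded linear operators on $\mathcal H$. Direct sums are Hilbert space (orthogonal) direct sums of closed subspaces. For $\mathbf T\in\mathcal B(\mathcal H)$ and a decomposition $\mathcal H=\bigoplus_{i=1}^s\mathcal H_i$, the component $\mathbf T_{i,j}:\mathcal H_j\to\mathcal H_i$ is $\mathbf T_{i,j}=\pi_{\mathcal H_i}\circ\mathbf T\circ\iota_{\mathcal H_j}$, with $\pi_{\mathcal H_i}:\mathcal H\to\mathcal H_i$ and $\iota_{\mathcal H_j}:\mathcal H_j\to\mathcal H$ the canonical projection and injection. A self-adjoint operator in $\mathcal B(\mathcal H)$ is called nonsingular if it is injective and has dense image. Skew-adjoint means $\mathbf J^*=-\mathbf J$. *)

theory Defs
  imports "HOL-Analysis.Analysis"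
begin

text \<open>
  The scalar field of a Hilbert space is \<open>\<real>\<close> or \<open>\<complex>\<close>. The following class captures exactly these two.
  Expanding \<open>(a + 1) * conj (a + 1)\<close> shows that \<open>a + conj a\<close> is a real number, so every \<open>a\<close> is a root
  of \<open>X\<^sup>2 - (a + conj a) X + a * conj a\<close>, a polynomial with real coefficients; hence the field is an
  algebraic extension of \<open>\<real>\<close>, its norm is the modulus, and \<open>conj\<close> is the usual conjugation.
\<close>

class real_or_complex = real_normed_field +
  fixes conj :: "'a \<Rightarrow> 'a"
  assumes conj_add: "conj (a + b) = conj a + conj b"
    and conj_mult: "conj (a * b) = conj a * conj b"
    and conj_conj: "conj (conj a) = a"
    and mult_conj: "a * conj a = (norm a)\<^sup>2 *\<^sub>R 1"

instantiation real :: real_or_complex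
begin
definition conj_real :: "real \<Rightarrow> real" where "conj_real a = a"
instance by standard (simp_all add: conj_real_def power2_eq_square)
end

instantiation complex :: real_or_complex
begin
definition conj_complex :: "complex \<Rightarrow> complex" where "conj_complex a = cnj a"
instance by standard
  (simp_all add: conj_complex_def complex_norm_square[symmetric] scaleR_conv_of_real)
end

text \<open>
  Completeness and the compatibility of norm, metric and topology are provided by the sort \<open>banach\<close>.
  The inner product is linear in its first argument.
\<close>

locale hilbert_space = vector_space smul
  for smul :: "'k::real_or_complex \<Rightarrow> 'a::banach \<Rightarrow> 'a" +
  fixes ip :: "'a \<Rightarrow> 'a \<Rightarrow> 'k"
  assumes smul_of_real: "smul (of_real r) x = r *\<^sub>R x"
    and ip_add_left: "ip (x + y) z = ip x z + ip y z"
    and ip_smul_left: "ip (smul c x) y = c * ip x y"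
    and ip_commute: "ip x y = conj (ip y x)"
    and ip_norm: "ip x x = of_real ((norm x)\<^sup>2)"

lemma hilbert_space_real:
  "hilbert_space scaleR (inner :: 'a::{real_inner, banach} \<Rightarrow> 'a \<Rightarrow> real)"
  by unfold_locales
    (simp_all add: conj_real_def algebra_simps inner_commute power2_norm_eq_inner)

lemma hilbert_space_complex: "hilbert_space (*) (\<lambda>x y :: complex. x * cnj y)"
  by unfold_locales
    (simp_all add: conj_complex_def algebra_simps scaleR_conv_of_real complex_norm_square[symmetric])

definition bounded_operator ::
    "('k::real_or_complex \<Rightarrow> 'a::banach \<Rightarrow> 'a) \<Rightarrow> ('a \<Rightarrow> 'a) \<Rightarrow> bool" where
  "bounded_operator smul T \<longleftrightarrow> Vector_Spaces.linear smul smul T \<and> bounded_linear T"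

definition fin_dim ::
    "('k::real_or_complex \<Rightarrow> 'a::banach \<Rightarrow> 'a) \<Rightarrow> 'a set \<Rightarrow> bool" where
  "fin_dim smul S \<longleftrightarrow> (\<exists>B. finite B \<and> B \<subseteq> S \<and> module.span smul B = S)"

definition orth_proj ::
    "('a::banach \<Rightarrow> 'a \<Rightarrow> 'k::real_or_complex) \<Rightarrow> 'a set \<Rightarrow> 'a \<Rightarrow> 'a" where
  "orth_proj ip U x = (THE y. y \<in> U \<and> (\<forall>z\<in>U. ip (x - y) z = 0))"

text \<open>
  \<open>adj ip U A\<close> is the adjoint \<open>V \<rightarrow> U\<close> of a bounded operator \<open>A : U \<rightarrow> V\<close> between closed subspaces;
  its values are meaningful on \<open>V\<close> only. The description is well defined by the Riesz
  representation theorem on \<open>U\<close>.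
\<close>

definition adj ::
    "('a::banach \<Rightarrow> 'a \<Rightarrow> 'k::real_or_complex) \<Rightarrow> 'a set \<Rightarrow> ('a \<Rightarrow> 'a) \<Rightarrow> 'a \<Rightarrow> 'a" where
  "adj ip U A y = (THE z. z \<in> U \<and> (\<forall>x\<in>U. ip (A x) y = ip x z))"

definition self_adjoint ::
    "('a::banach \<Rightarrow> 'a \<Rightarrow> 'k::real_or_complex) \<Rightarrow> ('a \<Rightarrow> 'a) \<Rightarrow> bool" where
  "self_adjoint ip T \<longleftrightarrow> adj ip UNIV T = T"

definition skew_adjoint ::
    "('a::banach \<Rightarrow> 'a \<Rightarrow> 'k::real_or_complex) \<Rightarrow> ('a \<Rightarrow> 'a) \<Rightarrow> bool" where
  "skew_adjoint ip T \<longleftrightarrow> adj ip UNIV T = (\<lambda>x. - T x)"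

definition nonsingular :: "('a::banach \<Rightarrow> 'a) \<Rightarrow> bool" where
  "nonsingular T \<longleftrightarrow> inj T \<and> closure (range T) = UNIV"

definition orth_direct_sum ::
    "('k::real_or_complex \<Rightarrow> 'a::banach \<Rightarrow> 'a) \<Rightarrow> ('a \<Rightarrow> 'a \<Rightarrow> 'k) \<Rightarrow> nat \<Rightarrow> (nat \<Rightarrow> 'a set) \<Rightarrow> bool" where
  "orth_direct_sum smul ip s H \<longleftrightarrow>
     (\<forall>i\<in>{1..s}. module.subspace smul (H i) \<and> closed (H i)) \<and>
     (\<forall>i\<in>{1..s}. \<forall>j\<in>{1..s}. i \<noteq> j \<longrightarrow> (\<forall>x\<in>H i. \<forall>y\<in>H j. ip x y = 0)) \<and>
     (\<forall>x. \<exists>f. (\<forall>i\<in>{1..s}. f i \<in> H i) \<and> x = (\<Sum>i=1..s. f i))"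

text \<open>
  \<open>component ip H T i j\<close> is the component \<open>T\<^sub>i\<^sub>,\<^sub>j : H j \<rightarrow> H i\<close>; the inclusion of \<open>H j\<close> is implicit, so
  only its values on \<open>H j\<close> matter. For an orthogonal direct sum the canonical projection onto a
  summand is the orthogonal projection.
\<close>

definition component ::
    "('a::banach \<Rightarrow> 'a \<Rightarrow> 'k::real_or_complex) \<Rightarrow> (nat \<Rightarrow> 'a set) \<Rightarrow> ('a \<Rightarrow> 'a) \<Rightarrow> nat \<Rightarrow> nat \<Rightarrow> 'a \<Rightarrow> 'a"
  where "component ip H T i j x = orth_proj ip (H i) (T x)"

end

theory Submission
  imports Defs
begin

text \<open>
  Let \<open>W = ker R\<close> and \<open>V = W\<^sup>\<bottom>\<close>. Since \<open>R\<close> is self-adjoint, it lives on \<open>V\<close> alone, so every refinement of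
  the splitting \<open>V \<oplus> W\<close> that keeps \<open>V\<close> as first summand gives \<open>R\<close> the required form. The summand
  \<open>W\<close> is refined by a staircase construction: let \<open>U\<close> be the projection of \<open>J V\<close> to \<open>W\<close>. If
  \<open>U = 0\<close>, then \<open>J\<close> does not couple \<open>V\<close> with \<open>W\<close>, and \<open>W\<close> becomes the last, decoupled summand.
  Otherwise \<open>U\<close> becomes the next summand, onto which \<open>J\<close> maps \<open>V\<close> by choice of \<open>U\<close>, and the
  construction continues with \<open>U\<close> and \<open>W \<ominus> U\<close> in place of \<open>V\<close> and \<open>W\<close>. As \<open>J V\<close> has no component in
  \<open>W \<ominus> U\<close>, no later summand is coupled with \<open>V\<close>. The dimension of \<open>W\<close> is finite and drops in each
  step, so this ends (\<open>staircase_exists\<close>). It produces zeros only on one side of the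
  tridiagonal band; skew-adjointness of \<open>J\<close> provides those on the other side.
  If \<open>R\<close> is injective, then \<open>W = 0\<close> and the construction ends at once.

  Two analytic facts are needed. The existence of adjoints, hence the rule for moving \<open>J\<close> and \<open>R\<close>
  across the inner product, rests on the Riesz representation theorem. All the subspaces that occur
  are finite-dimensional or the orthogonal complement of a finite-dimensional one, so their
  orthogonal projections come from Gram-Schmidt.
\<close>

section \<open>The inner product over the field of real or complex scalars\<close>

lemma conj_0: "conj (0::'k::real_or_complex) = 0"
  using conj_add[of "0::'k" 0] by simp

lemma conj_of_real: "conj (of_real r) = (of_real r :: 'k::real_or_complex)"
proof (cases "r = 0")
  case False
  have "(of_real r :: 'k) * conj (of_real r) = of_real r * of_real r"
    by (simp add: mult_conj scaleR_conv_of_real power2_eq_square)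
  with False show ?thesis
    by simp
qed (simp add: conj_0)

context hilbert_space
begin

lemma ip_add_right: "ip x (y + z) = ip x y + ip x z"
  by (metis conj_add ip_add_left ip_commute)

lemma ip_smul_right: "ip x (smul c y) = conj c * ip x y"
  by (metis conj_mult ip_smul_left ip_commute)

lemma ip_zero_left [simp]: "ip 0 y = 0"
  using ip_add_left[of 0 0 y] by simp

lemma ip_zero_right [simp]: "ip y 0 = 0"
  using ip_add_right[of y 0 0] by simp

lemma ip_minus_left: "ip (- x) y = - ip x y"
  using ip_add_left[of x "- x" y] by (simp add: eq_neg_iff_add_eq_0 add.commute)

lemma ip_minus_right: "ip x (- y) = - ip x y"
  using ip_add_right[of x y "- y"] by (simp add: eq_neg_iff_add_eq_0 add.commute)

lemma ip_diff_left: "ip (x - y) z = ip x z - ip y z"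
  using ip_add_left[of x "- y" z] by (simp add: ip_minus_left)

lemma ip_diff_right: "ip x (y - z) = ip x y - ip x z"
  using ip_add_right[of x y "- z"] by (simp add: ip_minus_right)

lemmas ip_simps = ip_add_left ip_add_right ip_smul_left ip_smul_right
  ip_minus_left ip_minus_right ip_diff_left ip_diff_right

lemma ip_self_eq_0 [simp]: "ip x x = 0 \<longleftrightarrow> x = 0"
  by (simp add: ip_norm)

lemma ip_eq_0_commute: "ip x y = 0 \<longleftrightarrow> ip y x = 0"
  by (metis conj_0 ip_commute)

lemma parallelogram:
  fixes x y :: 'a
  shows "(norm (x + y))\<^sup>2 + (norm (x - y))\<^sup>2 = 2 * (norm x)\<^sup>2 + 2 * (norm y)\<^sup>2"
proof -
  have "ip (x + y) (x + y) + ip (x - y) (x - y) = 2 * ip x x + 2 * ip y y"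
    by (simp add: ip_simps)
  then have "(of_real ((norm (x + y))\<^sup>2 + (norm (x - y))\<^sup>2) :: 'k) =
      of_real (2 * (norm x)\<^sup>2 + 2 * (norm y)\<^sup>2)"
    by (simp add: ip_norm)
  then show ?thesis
    by (simp only: of_real_eq_iff)
qed

text \<open>
  Pythagoras for the part of \<open>u\<close> orthogonal to \<open>z\<close>. Nonnegativity of the left-hand side gives
  Cauchy-Schwarz; minimality of the norm of \<open>u\<close> on the line \<open>u + \<langle>z\<rangle>\<close> gives \<open>u \<bottom> z\<close>.
\<close>

lemma norm_orthogonal_part:
  assumes "z \<noteq> 0"
  shows "(norm (u - smul (ip u z / of_real ((norm z)\<^sup>2)) z))\<^sup>2
    = (norm u)\<^sup>2 - (norm (ip u z))\<^sup>2 / (norm z)\<^sup>2"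
proof -
  define N :: 'k where "N = of_real ((norm z)\<^sup>2)"
  define c where "c = ip u z / N"
  have N: "N \<noteq> 0" "ip z z = N"
    using assms by (simp_all add: N_def ip_norm)
  have "conj N = N"
    by (simp add: N_def conj_of_real del: of_real_power)
  then have "conj c * N = ip z u"
    by (metis N(1) c_def conj_mult ip_commute nonzero_eq_divide_eq)
  then have cc: "conj c = ip z u / N"
    using N by (simp add: field_simps)
  have "ip (u - smul c z) (u - smul c z) = ip u u - conj c * ip u z - c * ip z u + c * conj c * N"
    by (simp add: ip_simps N algebra_simps)
  also have "\<dots> = ip u u - ip u z * ip z u / N"
    using N by (simp add: cc c_def field_simps)
  also have "ip u z * ip z u = of_real ((norm (ip u z))\<^sup>2)"
    using mult_conj[of "ip u z"] ip_commute[of z u] by (simp add: scaleR_conv_of_real)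
  finally have "(of_real ((norm (u - smul c z))\<^sup>2) :: 'k)
      = of_real ((norm u)\<^sup>2 - (norm (ip u z))\<^sup>2 / (norm z)\<^sup>2)"
    by (simp add: ip_norm N_def)
  then show ?thesis
    by (simp only: of_real_eq_iff c_def N_def)
qed

lemma Cauchy_Schwarz: "norm (ip x y) \<le> norm x * norm y"
proof (cases "y = 0")
  case False
  have "0 \<le> (norm x)\<^sup>2 - (norm (ip x y))\<^sup>2 / (norm y)\<^sup>2"
    using norm_orthogonal_part[OF False, of x] by (metis zero_le_power2)
  then have "(norm (ip x y))\<^sup>2 \<le> (norm x * norm y)\<^sup>2"
    using False by (simp add: field_simps power_mult_distrib)
  then show ?thesis
    by (rule power2_le_imp_le) simp
qed simp

lemma bounded_linear_ip_left: "bounded_linear (\<lambda>x. ip x y)"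
proof (rule bounded_linear_intro[where K = "norm y"])
  show "ip (r *\<^sub>R x) y = r *\<^sub>R ip x y" for r x
    by (simp add: smul_of_real[symmetric] ip_smul_left scaleR_conv_of_real)
qed (simp_all add: ip_add_left Cauchy_Schwarz)

section \<open>The Riesz representation theorem and adjoints\<close>

text \<open>
  By the parallelogram law, two points of \<open>C\<close> whose norms are close to the infimum are close to each
  other, their midpoint being in \<open>C\<close> as well; completeness then provides the minimiser.
\<close>

lemma minimal_norm_point:
  fixes C :: "'a set"
  assumes "closed C" "C \<noteq> {}"
    and mid: "\<And>x y. x \<in> C \<Longrightarrow> y \<in> C \<Longrightarrow> (1/2) *\<^sub>R (x + y) \<in> C"
  shows "\<exists>u\<in>C. \<forall>x\<in>C. norm u \<le> norm x"
proof -
  define d where "d = (INF x\<in>C. (norm x)\<^sup>2)"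
  have bdd: "bdd_below ((\<lambda>x. (norm x)\<^sup>2) ` C)"
    by (rule bdd_belowI2[where m = 0]) simp
  have d_le: "d \<le> (norm x)\<^sup>2" if "x \<in> C" for x
    unfolding d_def using bdd that by (rule cINF_lower)
  define S where "S n = {x \<in> C. (norm x)\<^sup>2 \<le> d + inverse (real (Suc n))}" for n
  have "closed (S n)" for n
  proof -
    have "closed {x::'a. (norm x)\<^sup>2 \<le> d + inverse (real (Suc n))}"
      by (intro closed_Collect_le continuous_intros)
    then show ?thesis
      using closed_Int[OF assms(1)] by (simp add: S_def Collect_conj_eq)
  qed
  moreover have "S n \<noteq> {}" for n
  proof -
    have "\<exists>x\<in>C. (norm x)\<^sup>2 < d + inverse (real (Suc n))"
      unfolding d_def using assms(2) bdd by (subst cINF_less_iff[symmetric]) simp_all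
    then show ?thesis
      by (auto simp: S_def intro: less_imp_le)
  qed
  moreover have "S n \<subseteq> S m" if "m \<le> n" for m n
  proof -
    have "inverse (real (Suc n)) \<le> inverse (real (Suc m))"
      using that by (intro le_imp_inverse_le) simp_all
    then have "d + inverse (real (Suc n)) \<le> d + inverse (real (Suc m))"
      by (rule add_left_mono)
    then show ?thesis
      unfolding S_def by (blast intro: order_trans)
  qed
  moreover have "\<exists>n. \<forall>x\<in>S n. \<forall>y\<in>S n. dist x y < e" if "e > 0" for e
  proof -
    obtain n where n: "inverse (real (Suc n)) < e\<^sup>2 / 4"
      using reals_Archimedean[of "e\<^sup>2 / 4"] \<open>e > 0\<close> by auto
    have "dist x y < e" if "x \<in> S n" "y \<in> S n" for x y
    proof -
      have "(norm (x - y))\<^sup>2 = 2 * (norm x)\<^sup>2 + 2 * (norm y)\<^sup>2 - 4 * (norm ((1/2) *\<^sub>R (x + y)))\<^sup>2"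
        using parallelogram[of x y] by (simp add: power_mult_distrib power2_eq_square)
      also have "\<dots> \<le> 4 * inverse (real (Suc n))"
        using that d_le[of "(1/2) *\<^sub>R (x + y)"] mid[of x y] by (simp add: S_def)
      also have "\<dots> < e\<^sup>2"
        using n by simp
      finally show ?thesis
        using \<open>e > 0\<close> by (simp add: dist_norm power2_less_imp_less)
    qed
    then show ?thesis
      by blast
  qed
  ultimately obtain u where u: "\<And>n. u \<in> S n"
    using decreasing_closed_nest[of S] by metis
  have "(norm u)\<^sup>2 \<le> d"
  proof (rule field_le_epsilon)
    fix e :: real
    assume "e > 0"
    then obtain n where "inverse (real (Suc n)) < e"
      using reals_Archimedean by blast
    then show "(norm u)\<^sup>2 \<le> d + e"
      using u[of n] by (simp add: S_def)
  qed
  then have "norm u \<le> norm x" if "x \<in> C" for x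
    using d_le[OF that] by (meson norm_ge_zero order_trans power2_le_imp_le)
  moreover have "u \<in> C"
    using u[of 0] by (simp add: S_def)
  ultimately show ?thesis
    by blast
qed

text \<open>
  The point of smallest norm on the hyperplane \<open>f = 1\<close> is orthogonal to the kernel of \<open>f\<close>, so a
  multiple of it represents \<open>f\<close>.
\<close>

theorem Riesz_representation:
  assumes f: "bounded_linear f" and f_smul: "\<And>c x. f (smul c x) = c * f x"
  shows "\<exists>z. \<forall>x. f x = ip x z"
proof (cases "\<forall>x. f x = 0")
  case True
  then show ?thesis
    by (metis ip_zero_right)
next
  case False
  interpret f: bounded_linear f by (rule f)
  let ?C = "{x. f x = 1}"
  have "closed ?C"
    by (intro closed_Collect_eq continuous_intros f.continuous_on)
  moreover have "?C \<noteq> {}"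
  proof -
    obtain x where "f x \<noteq> 0"
      using False by blast
    then have "f (smul (inverse (f x)) x) = 1"
      by (simp add: f_smul)
    then show ?thesis
      by blast
  qed
  moreover have "(1/2) *\<^sub>R (x + y) \<in> ?C" if "x \<in> ?C" "y \<in> ?C" for x y
    using that by (simp add: f.scaleR f.add scaleR_conv_of_real)
  ultimately have "\<exists>u\<in>?C. \<forall>x\<in>?C. norm u \<le> norm x"
    by (rule minimal_norm_point)
  then obtain u where u: "f u = 1" and u_min: "\<And>x. f x = 1 \<Longrightarrow> norm u \<le> norm x"
    by auto
  have orth: "ip y u = 0" if "f y = 0" for y
  proof (cases "y = 0")
    case y: False
    let ?v = "u - smul (ip u y / of_real ((norm y)\<^sup>2)) y"
    have "f ?v = 1"
      using that u by (simp add: f.diff f_smul)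
    then have "(norm u)\<^sup>2 \<le> (norm ?v)\<^sup>2"
      by (intro power_mono u_min) simp_all
    then have "(norm (ip u y))\<^sup>2 / (norm y)\<^sup>2 \<le> 0"
      unfolding norm_orthogonal_part[OF y] by simp
    then have "ip u y = 0"
      using y by (simp add: divide_le_0_iff)
    then show ?thesis
      by (simp add: ip_eq_0_commute)
  qed simp
  have "u \<noteq> 0"
    using u f.zero by auto
  define z where "z = smul (of_real (inverse ((norm u)\<^sup>2))) u"
  have "f x = ip x z" for x
  proof -
    have "f (x - smul (f x) u) = 0"
      using u by (simp add: f.diff f_smul)
    then have "ip x u = f x * of_real ((norm u)\<^sup>2)"
      using orth[of "x - smul (f x) u"] by (simp add: ip_diff_left ip_smul_left ip_norm)
    moreover have "of_real (inverse ((norm u)\<^sup>2)) * (of_real ((norm u)\<^sup>2) :: 'k) = 1"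
      using \<open>u \<noteq> 0\<close> by (simp flip: of_real_mult)
    ultimately show ?thesis
      by (simp only: z_def ip_smul_right conj_of_real mult.left_commute mult_1_right)
  qed
  then show ?thesis
    by blast
qed

lemma eq_if_ip_eq:
  assumes "y \<in> U" "z \<in> U" "subspace U" "\<And>x. x \<in> U \<Longrightarrow> ip x y = ip x z"
  shows "y = z"
proof -
  have "ip (y - z) (y - z) = 0"
    using assms by (simp add: ip_diff_right subspace_diff)
  then show ?thesis
    by simp
qed

lemma adj_eqI:
  assumes "subspace U" "z \<in> U" "\<And>x. x \<in> U \<Longrightarrow> ip (A x) y = ip x z"
  shows "adj ip U A y = z"
  unfolding adj_def
proof (rule the_equality)
  fix w
  assume "w \<in> U \<and> (\<forall>x\<in>U. ip (A x) y = ip x w)"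
  then show "w = z"
    using assms by (intro eq_if_ip_eq[of w U z]) simp_all
qed (use assms in auto)

text \<open>
  The existence of the adjoint has to be established here, since without it the description that
  defines \<open>adj\<close> would say nothing.
\<close>

lemma ip_adj:
  assumes "bounded_operator smul T"
  shows "ip (T x) y = ip x (adj ip UNIV T y)"
proof -
  interpret T: Vector_Spaces.linear smul smul T
    using assms by (simp add: bounded_operator_def)
  have "bounded_linear T"
    using assms by (simp add: bounded_operator_def)
  with bounded_linear_ip_left have "bounded_linear (\<lambda>x. ip (T x) y)"
    by (rule bounded_linear_compose)
  then obtain z where z: "\<And>x. ip (T x) y = ip x z"
    using Riesz_representation[of "\<lambda>x. ip (T x) y"] by (auto simp: T.scale ip_smul_left)
  then have "adj ip UNIV T y = z"
    by (intro adj_eqI) simp_all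
  with z show ?thesis
    by simp
qed

section \<open>Orthogonal projections\<close>

text \<open>
  A common property of finite-dimensional subspaces and of their orthogonal complements
  that makes \<open>orth_proj\<close> meaningful.
\<close>

definition projectable :: "'a set \<Rightarrow> bool" where
  "projectable U \<longleftrightarrow> subspace U \<and> (\<forall>x. \<exists>y\<in>U. \<forall>z\<in>U. ip (x - y) z = 0)"

definition orth_compl :: "'a set \<Rightarrow> 'a set" where
  "orth_compl U = {x. \<forall>z\<in>U. ip x z = 0}"

lemma projectable_subspace: "projectable U \<Longrightarrow> subspace U"
  by (simp add: projectable_def)

lemma orth_proj_eqI:
  assumes "subspace U" "y \<in> U" "\<And>z. z \<in> U \<Longrightarrow> ip (x - y) z = 0"
  shows "orth_proj ip U x = y"
  unfolding orth_proj_def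
proof (rule the_equality)
  fix w
  assume w: "w \<in> U \<and> (\<forall>z\<in>U. ip (x - w) z = 0)"
  have "ip z w = ip z y" if "z \<in> U" for z
  proof -
    have "ip (x - w) z = 0" "ip (x - y) z = 0"
      using w assms(3) that by auto
    then have "ip z (x - w) = 0" "ip z (x - y) = 0"
      by (simp_all add: ip_eq_0_commute)
    then show ?thesis
      by (simp add: ip_diff_right)
  qed
  then show "w = y"
    using assms w by (intro eq_if_ip_eq[of w U y]) simp_all
qed (use assms in auto)

lemma orth_proj_in_and_orth:
  assumes "projectable U"
  shows "orth_proj ip U x \<in> U \<and> (\<forall>z\<in>U. ip (x - orth_proj ip U x) z = 0)"
proof -
  obtain y where y: "y \<in> U" "\<And>z. z \<in> U \<Longrightarrow> ip (x - y) z = 0"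
    using assms unfolding projectable_def by blast
  then have "orth_proj ip U x = y"
    by (intro orth_proj_eqI projectable_subspace assms)
  with y show ?thesis
    by simp
qed

lemma orth_proj_in: "projectable U \<Longrightarrow> orth_proj ip U x \<in> U"
  by (simp add: orth_proj_in_and_orth)

lemma ip_diff_orth_proj: "projectable U \<Longrightarrow> z \<in> U \<Longrightarrow> ip (x - orth_proj ip U x) z = 0"
  by (simp add: orth_proj_in_and_orth)

lemma ip_orth_proj_left: "projectable U \<Longrightarrow> z \<in> U \<Longrightarrow> ip (orth_proj ip U x) z = ip x z"
  using ip_diff_orth_proj[of U z x] by (simp add: ip_diff_left)

lemma ip_orth_proj_right: "projectable U \<Longrightarrow> z \<in> U \<Longrightarrow> ip z (orth_proj ip U x) = ip z x"
  by (metis ip_commute ip_orth_proj_left)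

lemma orth_proj_eq_0: "subspace U \<Longrightarrow> (\<And>z. z \<in> U \<Longrightarrow> ip x z = 0) \<Longrightarrow> orth_proj ip U x = 0"
  by (rule orth_proj_eqI) (simp_all add: subspace_0)

lemma linear_orth_proj:
  assumes "projectable U"
  shows "Vector_Spaces.linear smul smul (orth_proj ip U)"
proof
  note sub = projectable_subspace[OF assms]
  show "orth_proj ip U (x + y) = orth_proj ip U x + orth_proj ip U y" for x y
    using assms
    by (intro orth_proj_eqI)
      (simp_all add: sub subspace_add orth_proj_in ip_simps ip_orth_proj_left)
  show "orth_proj ip U (smul c x) = smul c (orth_proj ip U x)" for c x
    using assms
    by (intro orth_proj_eqI)
      (simp_all add: sub subspace_scale orth_proj_in ip_simps ip_orth_proj_left)
qed

lemma subspace_orth_compl: "subspace (orth_compl U)"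
  by (rule subspaceI) (simp_all add: orth_compl_def ip_simps)

lemma closed_orth_compl: "closed (orth_compl U)"
proof -
  have "orth_compl U = (\<Inter>z\<in>U. {x. ip x z = 0})"
    by (auto simp: orth_compl_def)
  moreover have "closed {x. ip x z = 0}" for z
    by (intro closed_Collect_eq continuous_intros
        bounded_linear.continuous_on[OF bounded_linear_ip_left])
  ultimately show ?thesis
    by (simp add: closed_INT)
qed

lemma projectable_orth_compl:
  assumes "projectable U"
  shows "projectable (orth_compl U)"
proof -
  have "\<exists>y\<in>orth_compl U. \<forall>z\<in>orth_compl U. ip (x - y) z = 0" for x
  proof (intro bexI[of _ "x - orth_proj ip U x"] ballI)
    show "x - orth_proj ip U x \<in> orth_compl U"
      using ip_diff_orth_proj[OF assms] by (simp add: orth_compl_def)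
    fix z
    assume "z \<in> orth_compl U"
    then have "ip z (orth_proj ip U x) = 0"
      using orth_proj_in[OF assms] by (simp add: orth_compl_def)
    then show "ip (x - (x - orth_proj ip U x)) z = 0"
      by (simp add: ip_eq_0_commute)
  qed
  then show ?thesis
    by (simp add: projectable_def subspace_orth_compl)
qed

text \<open>A subspace with an orthogonal projection equals its double orthogonal complement.\<close>

lemma closed_projectable:
  assumes "projectable U"
  shows "closed U"
proof -
  have "orth_compl (orth_compl U) \<subseteq> U"
  proof
    fix x
    assume x: "x \<in> orth_compl (orth_compl U)"
    let ?d = "x - orth_proj ip U x"
    have d: "?d \<in> orth_compl U"
      using ip_diff_orth_proj[OF assms] by (simp add: orth_compl_def)
    have "ip x ?d = 0"
      using x d by (simp add: orth_compl_def)
    moreover have "ip (orth_proj ip U x) ?d = 0"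
      using d orth_proj_in[OF assms] by (simp add: orth_compl_def ip_eq_0_commute)
    ultimately have "ip ?d ?d = 0"
      by (simp only: ip_diff_left diff_self)
    then show "x \<in> U"
      using orth_proj_in[OF assms, of x] by simp
  qed
  moreover have "U \<subseteq> orth_compl (orth_compl U)"
    by (auto simp: orth_compl_def ip_eq_0_commute)
  ultimately show ?thesis
    using closed_orth_compl[of "orth_compl U"] by simp
qed

text \<open>
  Gram-Schmidt: enlarging a spanning set by \<open>b\<close> adds the component of \<open>x\<close> along
  the part of \<open>b\<close> orthogonal to the old span.
\<close>

lemma projectable_span:
  assumes "finite B"
  shows "projectable (span B)"
  using assms
proof (induction B)
  case empty
  then show ?case
    by (simp add: projectable_def subspace_single_0)
next
  case (insert b B)
  note IH = insert.IH
  let ?P = "orth_proj ip (span B)"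
  define c where "c = b - ?P b"
  have c_orth: "ip c z = 0" if "z \<in> span B" for z
    unfolding c_def using IH that by (rule ip_diff_orth_proj)
  have P_in: "?P x \<in> span (insert b B)" for x
    using orth_proj_in[OF IH, of x] span_mono[of B "insert b B"] by auto
  have c_in: "c \<in> span (insert b B)"
    unfolding c_def using P_in span_base[of b "insert b B"] by (intro span_diff) simp_all
  have "\<exists>y\<in>span (insert b B). \<forall>z\<in>span (insert b B). ip (x - y) z = 0" for x
  proof -
    (* For b in span B, i.e. c = 0, division by zero makes q = 0, and the projection is unchanged. *)
    define q where "q = ip x c / ip c c"
    have q: "q * ip c c = ip x c"
      by (cases "c = 0") (simp_all add: q_def)
    let ?y = "?P x + smul q c"
    have "ip (x - ?y) z = 0" if z: "z \<in> span (insert b B)" for z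
    proof -
      obtain k where "z - smul k b \<in> span B"
        using z span_breakdown_eq[of z b B] by auto
      then have t: "z - smul k c \<in> span B" (is "?t \<in> _")
        using span_add[OF _ span_scale[OF orth_proj_in[OF IH, of b], of k], of "z - smul k b"]
        by (simp add: c_def scale_right_diff_distrib algebra_simps)
      have "ip (?P x) c = 0"
        using c_orth[OF orth_proj_in[OF IH]] by (simp add: ip_eq_0_commute)
      then have "ip (x - ?y) c = 0"
        by (simp add: ip_simps q)
      moreover have "ip (x - ?y) ?t = 0"
        using ip_diff_orth_proj[OF IH t, of x] c_orth[OF t]
        by (simp only: ip_diff_left ip_add_left ip_smul_left) simp
      moreover have "ip (x - ?y) z = ip (x - ?y) ?t + conj k * ip (x - ?y) c"
        by (simp only: ip_diff_right ip_smul_right) simp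
      ultimately show ?thesis
        by simp
    qed
    moreover have "?y \<in> span (insert b B)"
      using P_in c_in by (intro span_add span_scale)
    ultimately show ?thesis
      by blast
  qed
  then show ?case
    by (simp add: projectable_def subspace_span)
qed

lemma basis_of_subspace_of_span:
  assumes "subspace U" "U \<subseteq> span B" "finite B"
  obtains C where "finite C" "C \<subseteq> U" "span C = U" "independent C"
proof -
  obtain C where C: "C \<subseteq> U" "independent C" "U \<subseteq> span C"
    using maximal_independent_subset[of U] by blast
  moreover from C have "span C = U"
    using assms(1) span_minimal by blast
  moreover from C have "finite C"
    using independent_span_bound[of B C] assms by auto
  ultimately show thesis
    using that by blast
qed

lemma fin_dim_subspace:
  assumes "fin_dim smul W" "subspace U" "U \<subseteq> W"
  shows "fin_dim smul U"
proof -
  obtain B where "finite B" "span B = W"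
    using assms(1) by (auto simp: fin_dim_def)
  with assms show ?thesis
    unfolding fin_dim_def by (metis basis_of_subspace_of_span)
qed

lemma projectable_fin_dim: "fin_dim smul U \<Longrightarrow> projectable U"
  using projectable_span by (auto simp: fin_dim_def)

section \<open>Adjoints of operator blocks\<close>

lemma adj_block:
  assumes "projectable U" "projectable V" "y \<in> V" and adj: "\<And>x y. ip (T x) y = ip x (T' y)"
  shows "adj ip U (\<lambda>x. orth_proj ip V (T x)) y = orth_proj ip U (T' y)"
  using assms(1-3)
  by (intro adj_eqI)
    (simp_all add: projectable_subspace orth_proj_in ip_orth_proj_left ip_orth_proj_right adj)

text \<open>The kernel of an adjoint is the orthogonal complement of the range.\<close>

lemma inj_on_adj_of_surjective_block:
  assumes "projectable U" "projectable V" and adj: "\<And>x y. ip (T x) y = ip x (T' y)"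
    and surj: "(\<lambda>x. orth_proj ip V (T x)) ` U = V"
  shows "inj_on (\<lambda>y. - adj ip U (\<lambda>x. orth_proj ip V (T x)) y) V"
proof (rule inj_onI)
  fix y z
  assume yz: "y \<in> V" "z \<in> V"
    and "- adj ip U (\<lambda>x. orth_proj ip V (T x)) y = - adj ip U (\<lambda>x. orth_proj ip V (T x)) z"
  then have eq: "orth_proj ip U (T' y) = orth_proj ip U (T' z)"
    by (simp add: adj_block[OF assms(1,2) _ adj])
  have "ip (orth_proj ip V (T x)) y = ip (orth_proj ip V (T x)) z" if "x \<in> U" for x
    using yz assms(1,2) that eq by (metis ip_orth_proj_left ip_orth_proj_right adj)
  then have "\<forall>v\<in>(\<lambda>x. orth_proj ip V (T x)) ` U. ip v y = ip v z"
    by blast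
  then show "y = z"
    unfolding surj
    using yz assms(2) by (intro eq_if_ip_eq[of y V z] projectable_subspace) simp_all
qed

end

section \<open>The staircase construction\<close>

text \<open>
  A splitting of \<open>V \<oplus> W\<close> into \<open>G 0 = V\<close>, the blocks \<open>G 1, \<dots>, G m\<close> that are reached
  from \<open>V\<close> by repeated application of \<open>J\<close>, and an unreachable rest \<open>G (m + 1)\<close>. The blocks count
  from \<open>0\<close> so that one step of the construction prepends a block with \<open>case_nat\<close>.
  Requiring nonzero blocks between the first and the last forces \<open>m = 0\<close> when \<open>W = {0}\<close>.
\<close>

locale staircase = hilbert_space smul ip
  for smul :: "'k::real_or_complex \<Rightarrow> 'a::banach \<Rightarrow> 'a" and ip :: "'a \<Rightarrow> 'a \<Rightarrow> 'k" +
  fixes J :: "'a \<Rightarrow> 'a" and V W :: "'a set" and m :: nat and G :: "nat \<Rightarrow> 'a set"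
  assumes first: "G 0 = V"
    and subspace: "i \<le> m \<Longrightarrow> subspace (G (Suc i))"
    and inside: "i \<le> m \<Longrightarrow> G (Suc i) \<subseteq> W"
    and orthogonal: "i \<le> m \<Longrightarrow> j \<le> m \<Longrightarrow> i \<noteq> j \<Longrightarrow> x \<in> G (Suc i) \<Longrightarrow> y \<in> G (Suc j) \<Longrightarrow> ip x y = 0"
    and decompose: "v \<in> V \<Longrightarrow> w \<in> W \<Longrightarrow>
      \<exists>f. (\<forall>i\<le>Suc m. f i \<in> G i) \<and> v + w = (\<Sum>i\<le>Suc m. f i)"
    and surjective: "i < m \<Longrightarrow> (\<lambda>x. orth_proj ip (G (Suc i)) (J x)) ` G i = G (Suc i)"
    and nonzero: "i < m \<Longrightarrow> G (Suc i) \<noteq> {0}"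
    and hessenberg: "i + 2 \<le> j \<Longrightarrow> j \<le> Suc m \<Longrightarrow> x \<in> G i \<Longrightarrow> y \<in> G j \<Longrightarrow> ip (J x) y = 0"
    and decoupled: "x \<in> G m \<Longrightarrow> y \<in> G (Suc m) \<Longrightarrow> ip (J x) y = 0"

context hilbert_space
begin

lemma staircase_decoupled:
  assumes "subspace W" "\<And>x y. x \<in> V \<Longrightarrow> y \<in> W \<Longrightarrow> ip (J x) y = 0"
  shows "staircase smul ip J V W 0 (case_nat V (\<lambda>_. W))"
proof unfold_locales
  show "\<exists>f. (\<forall>i\<le>Suc 0. f i \<in> case_nat V (\<lambda>_. W) i) \<and> v + w = (\<Sum>i\<le>Suc 0. f i)"
    if "v \<in> V" "w \<in> W" for v w
    using that by (intro exI[of _ "case_nat v (\<lambda>_. w)"]) (auto split: nat.split)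
qed (use assms in auto)

text \<open>
  Prepending \<open>V\<close> to a staircase that starts with the part \<open>U\<close> of \<open>W\<close> reached from \<open>V\<close> by \<open>J\<close>. Since
  \<open>J V\<close> projects into \<open>U\<close>, it is orthogonal to the part of \<open>W\<close> that the later blocks fill.
\<close>

lemma staircase_step:
  assumes W: "projectable W" and U: "projectable U"
    and U_eq: "U = (\<lambda>x. orth_proj ip W (J x)) ` V" and "U \<noteq> {0}"
    and G: "staircase smul ip J U (W \<inter> orth_compl U) m G"
  shows "staircase smul ip J V W (Suc m) (case_nat V G)"
proof -
  let ?G = "case_nat V G"
  have "U \<subseteq> W"
    using orth_proj_in[OF W] by (auto simp: U_eq)
  interpret G: staircase smul ip J U "W \<inter> orth_compl U" m G
    by (rule G)
  have sub: "subspace (?G (Suc i)) \<and> ?G (Suc i) \<subseteq> W" if "i \<le> Suc m" for i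
    using that G.subspace[of "i - 1"] G.inside[of "i - 1"] \<open>U \<subseteq> W\<close> projectable_subspace[OF U]
    by (cases i) (auto simp: G.first)
  have U_orth: "ip x y = 0 \<and> ip y x = 0" if "x \<in> U" "y \<in> G (Suc j)" "j \<le> m" for x y j
    using that G.inside[of j] by (auto simp: orth_compl_def ip_eq_0_commute)
  have orth: "ip x y = 0" if "i \<le> Suc m" "j \<le> Suc m" "i \<noteq> j" "x \<in> ?G (Suc i)" "y \<in> ?G (Suc j)"
    for i j x y
    using that G.orthogonal U_orth by (cases i; cases j) (auto simp: G.first)
  have sum: "\<exists>f. (\<forall>i\<le>Suc (Suc m). f i \<in> ?G i) \<and> v + w = (\<Sum>i\<le>Suc (Suc m). f i)"
    if "v \<in> V" "w \<in> W" for v w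
  proof -
    let ?u = "orth_proj ip U w"
    have u: "?u \<in> U"
      by (rule orth_proj_in[OF U])
    moreover have "w - ?u \<in> W \<inter> orth_compl U"
      using that u \<open>U \<subseteq> W\<close> ip_diff_orth_proj[OF U] projectable_subspace[OF W]
      by (auto simp: orth_compl_def subspace_diff)
    ultimately obtain f where f: "\<And>i. i \<le> Suc m \<Longrightarrow> f i \<in> G i" "w = (\<Sum>i\<le>Suc m. f i)"
      using G.decompose[of ?u "w - ?u"] by auto
    show ?thesis
    proof (intro exI[of _ "case_nat v f"] conjI allI impI)
      show "case_nat v f i \<in> ?G i" if "i \<le> Suc (Suc m)" for i
        using that \<open>v \<in> V\<close> f(1) by (cases i) auto
      show "v + w = (\<Sum>i\<le>Suc (Suc m). case_nat v f i)"
        unfolding f(2) by (subst (2) sum.atMost_Suc_shift) simp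
    qed
  qed
  have proj_U: "orth_proj ip U (J x) = orth_proj ip W (J x)" if "x \<in> V" for x
    using that \<open>U \<subseteq> W\<close> ip_diff_orth_proj[OF W]
    by (intro orth_proj_eqI projectable_subspace[OF U]) (auto simp: U_eq)
  have surj: "(\<lambda>x. orth_proj ip (?G (Suc i)) (J x)) ` ?G i = ?G (Suc i) \<and> ?G (Suc i) \<noteq> {0}"
    if "i < Suc m" for i
  proof (cases i)
    case 0
    have "(\<lambda>x. orth_proj ip U (J x)) ` V = U"
      using proj_U by (subst (2) U_eq) (rule image_cong, simp_all)
    then show ?thesis
      using 0 \<open>U \<noteq> {0}\<close> by (simp add: G.first)
  next
    case (Suc i')
    then show ?thesis
      using that G.surjective[of i'] G.nonzero[of i'] by simp
  qed
  have V_orth: "ip (J x) y = 0" if "x \<in> V" "y \<in> G (Suc j)" "j \<le> m" for x y j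
  proof -
    have "y \<in> W" "ip (orth_proj ip W (J x)) y = 0"
      using that G.inside[of j] U_orth[of _ y j] by (auto simp: U_eq)
    then show ?thesis
      by (simp add: ip_orth_proj_left[OF W])
  qed
  have tri: "ip (J x) y = 0" if "i + 2 \<le> j" "j \<le> Suc (Suc m)" "x \<in> ?G i" "y \<in> ?G j" for i j x y
  proof (cases i)
    case 0
    then obtain k where "j = Suc (Suc k)"
      using \<open>i + 2 \<le> j\<close> by (auto simp: le_iff_add)
    with that 0 show ?thesis
      using V_orth by simp
  next
    case (Suc i')
    then obtain k where "j = Suc k"
      using \<open>i + 2 \<le> j\<close> by (auto simp: le_iff_add)
    with that Suc show ?thesis
      using G.hessenberg[of i' k] by simp
  qed
  show ?thesis
    by unfold_locales
      ((rule orth sum tri sub[THEN conjunct1] sub[THEN conjunct2] surj[THEN conjunct1]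
          surj[THEN conjunct2]; assumption) | simp add: G.decoupled)+
qed

text \<open>
  The construction stops because each step removes a nonzero subspace from \<open>W\<close>: a basis of the
  rest, together with a vector reached from \<open>V\<close>, is independent in \<open>W\<close>.
\<close>

lemma staircase_exists:
  assumes J: "Vector_Spaces.linear smul smul J" and "subspace V" "finite B" "W = span B"
  shows "\<exists>m G. staircase smul ip J V W m G"
  using assms(2-)
proof (induction "card B" arbitrary: V W B rule: less_induct)
  case less
  have W: "projectable W"
    using less.prems by (simp add: projectable_span)
  interpret J: Vector_Spaces.linear smul smul J by (rule J)
  interpret P: Vector_Spaces.linear smul smul "orth_proj ip W"
    using W by (rule linear_orth_proj)
  define U where "U = (\<lambda>x. orth_proj ip W (J x)) ` V"
  have "U = orth_proj ip W ` (J ` V)"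
    by (auto simp: U_def)
  then have "subspace U"
    using less.prems(1) by (simp add: J.subspace_image P.subspace_image)
  have "U \<subseteq> W"
    using orth_proj_in[OF W] by (auto simp: U_def)
  show ?case
  proof (cases "U = {0}")
    case True
    have "ip (J x) y = 0" if "x \<in> V" "y \<in> W" for x y
    proof -
      have "orth_proj ip W (J x) = 0"
        using True that by (auto simp: U_def)
      then show ?thesis
        using ip_orth_proj_left[OF W that(2), of "J x"] by simp
    qed
    then show ?thesis
      using staircase_decoupled projectable_subspace[OF W] by blast
  next
    case False
    then obtain u where u: "u \<in> U" "u \<noteq> 0"
      using subspace_0[OF \<open>subspace U\<close>] by blast
    obtain C where "finite C" "span C = U"
      using \<open>subspace U\<close> \<open>U \<subseteq> W\<close>[unfolded less.prems(3)] less.prems(2)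
      by (rule basis_of_subspace_of_span)
    then have U: "projectable U"
      using projectable_span by blast
    let ?W' = "W \<inter> orth_compl U"
    have "subspace ?W'"
      by (intro subspace_inter subspace_orth_compl projectable_subspace[OF W])
    moreover have "?W' \<subseteq> span B"
      using less.prems(3) by blast
    ultimately obtain D where D: "finite D" "D \<subseteq> ?W'" "span D = ?W'" "independent D"
      using less.prems(2) by (rule basis_of_subspace_of_span)
    have "u \<notin> span D"
      using u by (auto simp: D orth_compl_def intro!: bexI[of _ u])
    then have "independent (insert u D)" "u \<notin> D"
      using D span_base by (auto simp: independent_insert)
    moreover have "insert u D \<subseteq> span B"
      using D u \<open>U \<subseteq> W\<close> less.prems by auto
    ultimately have "card D < card B"
      using independent_span_bound[of B "insert u D"] D less.prems by auto
    then obtain m G where "staircase smul ip J U ?W' m G"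
      using less.hyps[of D U ?W'] D \<open>subspace U\<close> by metis
    then show ?thesis
      using staircase_step[OF W U U_def False] by blast
  qed
qed

end

section \<open>The decomposition\<close>

theorem lemma5p1:
  fixes smul :: "'k::real_or_complex \<Rightarrow> 'a::banach \<Rightarrow> 'a"
    and ip :: "'a \<Rightarrow> 'a \<Rightarrow> 'k"
    and J R :: "'a \<Rightarrow> 'a"
  assumes "hilbert_space smul ip"
    and "separable_space (euclidean :: 'a topology)"
    and "bounded_operator smul J" and "skew_adjoint ip J"
    and "bounded_operator smul R" and "self_adjoint ip R"
    and "fin_dim smul {x. R x = 0}"
  shows "\<exists>(s::nat) (H :: nat \<Rightarrow> 'a set).
    s \<ge> 2 \<and> orth_direct_sum smul ip s H \<and>
    (\<forall>i\<in>{2..s}. fin_dim smul (H i)) \<and>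
    ((\<forall>j\<in>{1..s}. \<forall>k\<in>{1..s}. \<forall>x\<in>H k.
        component ip H J j k x = - adj ip (H j) (component ip H J k j) x) \<and>
     (\<forall>j\<in>{1..s}. \<forall>k\<in>{1..s}. \<bar>int j - int k\<bar> \<ge> 2 \<longrightarrow>
        (\<forall>x\<in>H k. component ip H J j k x = 0)) \<and>
     (\<forall>x\<in>H (s - 1). component ip H J s (s - 1) x = 0) \<and>
     (\<forall>x\<in>H s. component ip H J (s - 1) s x = 0)) \<and>
    (s \<ge> 3 \<longrightarrow> (\<forall>i\<in>{2..s - 1}.
        component ip H J i (i - 1) ` H (i - 1) = H i \<and>
        inj_on (\<lambda>x. - adj ip (H (i - 1)) (component ip H J i (i - 1)) x) (H i))) \<and>
    ((\<forall>j\<in>{1..s}. \<forall>k\<in>{1..s}. j + k > 2 \<longrightarrow> (\<forall>x\<in>H k. component ip H R j k x = 0)) \<and>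
     (\<forall>x\<in>H 1. component ip H R 1 1 x = adj ip (H 1) (component ip H R 1 1) x)) \<and>
    (nonsingular R \<longrightarrow> s = 2 \<and> H 2 = {0})"
proof -
  interpret hilbert_space smul ip by fact
  let ?W = "{x. R x = 0}"
  let ?V = "orth_compl ?W"
  interpret J: Vector_Spaces.linear smul smul J
    using assms(3) by (simp add: bounded_operator_def)
  interpret R: Vector_Spaces.linear smul smul R
    using assms(5) by (simp add: bounded_operator_def)
  have J_adj: "ip (J x) y = ip x (- J y)" for x y
    using ip_adj[OF assms(3)] assms(4) by (simp add: skew_adjoint_def)
  have R_adj: "ip (R x) y = ip x (R y)" for x y
    using ip_adj[OF assms(5)] assms(6) by (simp add: self_adjoint_def)
  obtain B where B: "finite B" "?W = span B"
    using assms(7) by (auto simp: fin_dim_def)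
  have W: "projectable ?W"
    using assms(7) by (rule projectable_fin_dim)
  obtain m G where "staircase smul ip J ?V ?W m G"
    using staircase_exists[OF J.linear_axioms subspace_orth_compl B] by blast
  then interpret G: staircase smul ip J ?V ?W m G .
  define s where "s = Suc (Suc m)"
  define H where "H i = G (i - 1)" for i
  have comp: "component ip H T i j = (\<lambda>x. orth_proj ip (H i) (T x))" for T i j
    by (simp add: component_def fun_eq_iff)
  have H1: "H 1 = ?V"
    by (simp add: H_def G.first)
  have H_sub: "subspace (H i)" "H i \<subseteq> ?W" if i: "i \<in> {2..s}" for i
  proof -
    have "i = Suc (Suc (i - 2))" "i - 2 \<le> m"
      using i by (auto simp: s_def)
    then obtain i' where "i = Suc (Suc i')" "i' \<le> m"
      by blast
    then show "subspace (H i)" "H i \<subseteq> ?W"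
      using G.subspace[of i'] G.inside[of i'] by (simp_all add: H_def)
  qed
  have fd: "fin_dim smul (H i)" if "i \<in> {2..s}" for i
    using fin_dim_subspace[OF assms(7)] H_sub[OF that] by blast
  have proj: "projectable (H i)" if "i \<in> {1..s}" for i
  proof (cases "i = 1")
    case True
    then show ?thesis
      using projectable_orth_compl[OF W] H1 by simp
  next
    case False
    then show ?thesis
      using that projectable_fin_dim[OF fd[of i]] by auto
  qed
  have W_V: "ip x y = 0 \<and> ip y x = 0" if "x \<in> ?W" "y \<in> ?V" for x y
    using that unfolding orth_compl_def by (simp add: ip_eq_0_commute)
  have H_orth: "ip x y = 0" if ij: "i \<in> {1..s}" "j \<in> {1..s}" "i \<noteq> j"
    and xy: "x \<in> H i" "y \<in> H j" for i j x y
  proof -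
    consider "i = 1" "j \<in> {2..s}" | "j = 1" "i \<in> {2..s}" | "i \<noteq> 1" "j \<noteq> 1"
      using ij by force
    then show ?thesis
    proof cases
      case 1
      then show ?thesis
        using xy H1 H_sub(2)[of j] W_V by blast
    next
      case 2
      then show ?thesis
        using xy H1 H_sub(2)[of i] W_V by blast
    next
      case 3
      then have "i = Suc (Suc (i - 2))" "j = Suc (Suc (j - 2))" "i - 2 \<le> m" "j - 2 \<le> m"
        using ij by (auto simp: s_def)
      then obtain i' j' where "i = Suc (Suc i')" "j = Suc (Suc j')" "i' \<le> m" "j' \<le> m"
        by blast
      then show ?thesis
        using ij(3) xy by (intro G.orthogonal[of i' j']) (simp_all add: H_def)
    qed
  qed
  have H_tri: "ip (J x) y = 0"
    if "i \<in> {1..s}" "j \<in> {1..s}" "i + 2 \<le> j" "x \<in> H i" "y \<in> H j" for i j x y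
    using that by (intro G.hessenberg[of "i - 1" "j - 1"]) (auto simp: H_def s_def)
  (* Zeros of J below the diagonal band are also zeros above it. *)
  have flip: "ip (J x) y = 0 \<longleftrightarrow> ip (J y) x = 0" for x y
    by (simp add: J_adj[of x y] ip_minus_right ip_eq_0_commute)
  have decomposition: "\<exists>f. (\<forall>i\<in>{1..s}. f i \<in> H i) \<and> x = (\<Sum>i=1..s. f i)" for x
  proof -
    have "x - orth_proj ip ?W x \<in> ?V"
      using ip_diff_orth_proj[OF W] by (auto simp: orth_compl_def)
    from G.decompose[OF this orth_proj_in[OF W, of x]]
    obtain f where f: "\<And>i. i \<le> Suc m \<Longrightarrow> f i \<in> G i" "x = (\<Sum>i\<le>Suc m. f i)"
      by (auto simp del: sum.atMost_Suc)
    moreover have "(\<Sum>i=1..s. f (i - 1)) = (\<Sum>i\<le>Suc m. f i)"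
      unfolding s_def One_nat_def sum.shift_bounds_cl_Suc_ivl by (simp add: atMost_atLeast0)
    moreover have "f (i - 1) \<in> H i" if "i \<in> {1..s}" for i
      using that by (auto simp: H_def s_def intro!: f(1))
    ultimately show ?thesis
      by (intro exI[of _ "\<lambda>i. f (i - 1)"]) simp
  qed
  have s2: "s \<ge> 2"
    by (simp add: s_def)
  have direct_sum: "orth_direct_sum smul ip s H"
    unfolding orth_direct_sum_def
    using proj projectable_subspace closed_projectable H_orth decomposition by blast
  have skew: "component ip H J j k x = - adj ip (H j) (component ip H J k j) x"
    if "j \<in> {1..s}" "k \<in> {1..s}" "x \<in> H k" for j k x
  proof -
    interpret P: Vector_Spaces.linear smul smul "orth_proj ip (H j)"
      using that by (intro linear_orth_proj proj)
    have "adj ip (H j) (component ip H J k j) x = orth_proj ip (H j) (- J x)"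
      unfolding comp using adj_block[OF proj proj that(3) J_adj] that by blast
    also have "\<dots> = - orth_proj ip (H j) (J x)"
      by (rule P.neg)
    finally show ?thesis
      by (simp add: comp)
  qed
  have tri: "component ip H J j k x = 0"
    if "j \<in> {1..s}" "k \<in> {1..s}" "\<bar>int j - int k\<bar> \<ge> 2" "x \<in> H k" for j k x
  proof -
    have "j + 2 \<le> k \<or> k + 2 \<le> j"
      using that(3) by linarith
    then have "ip (J x) z = 0" if "z \<in> H j" for z
      using that \<open>j \<in> _\<close> \<open>k \<in> _\<close> \<open>x \<in> _\<close> H_tri flip by blast
    then show ?thesis
      unfolding comp using that by (intro orth_proj_eq_0 projectable_subspace proj)
  qed
  have last_row: "component ip H J s (s - 1) x = 0" if "x \<in> H (s - 1)" for x
    unfolding comp using that G.decoupled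
    by (intro orth_proj_eq_0 projectable_subspace proj) (auto simp: H_def s_def)
  have last_column: "component ip H J (s - 1) s x = 0" if "x \<in> H s" for x
    unfolding comp using that G.decoupled flip
    by (intro orth_proj_eq_0 projectable_subspace proj) (auto simp: H_def s_def)
  have onto: "component ip H J i (i - 1) ` H (i - 1) = H i \<and>
      inj_on (\<lambda>x. - adj ip (H (i - 1)) (component ip H J i (i - 1)) x) (H i)"
    if i: "i \<in> {2..s - 1}" for i
  proof -
    have "i = Suc (Suc (i - 2))" "i - 2 < m"
      using i by (auto simp: s_def)
    then obtain i' where i': "i = Suc (Suc i')" "i' < m"
      by blast
    have surj: "(\<lambda>x. orth_proj ip (H i) (J x)) ` H (i - 1) = H i"
      using G.surjective[of i'] i' by (simp add: H_def)
    moreover have "projectable (H (i - 1))" "projectable (H i)"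
      using i' by (auto intro!: proj simp: s_def)
    ultimately show ?thesis
      unfolding comp using inj_on_adj_of_surjective_block[OF _ _ J_adj] by blast
  qed
  have R0: "component ip H R j k x = 0"
    if "j \<in> {1..s}" "k \<in> {1..s}" "j + k > 2" "x \<in> H k" for j k x
  proof -
    have "j \<in> {2..s} \<or> k \<in> {2..s}"
      using that by auto
    then have "R z = 0 \<or> R x = 0" if "z \<in> H j" for z
      using that \<open>x \<in> H k\<close> H_sub(2) by blast
    then have "ip (R x) z = 0" if "z \<in> H j" for z
      using that R_adj[of x z] by (metis ip_zero_left ip_zero_right)
    then show ?thesis
      unfolding comp using that by (intro orth_proj_eq_0 projectable_subspace proj)
  qed
  have R11: "component ip H R 1 1 x = adj ip (H 1) (component ip H R 1 1) x"
    if "x \<in> H 1" for x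
    unfolding comp using proj[of 1] adj_block[OF _ _ that R_adj, of "H 1"] by (simp add: s_def)
  have nonsing: "s = 2 \<and> H 2 = {0}" if "nonsingular R"
  proof -
    have "inj R"
      using that by (simp add: nonsingular_def)
    then have "?W = {0}"
      using inj_eq[of R _ 0] by (simp add: R.zero)
    then have "G (Suc 0) = {0}"
      using G.inside[of 0] subspace_0[OF G.subspace[of 0]] by auto
    moreover from this have "m = 0"
      using G.nonzero[of 0] by auto
    ultimately show ?thesis
      by (simp add: s_def H_def)
  qed
  show ?thesis
    by (intro exI[of _ s] exI[of _ H] conjI ballI impI)
      (rule s2 direct_sum fd skew tri last_row last_column onto[THEN conjunct1] onto[THEN conjunct2]
        R0 R11 nonsing[THEN conjunct1] nonsing[THEN conjunct2]; assumption)+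
qed

end
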